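(* For $n\ge 1$ let $P_n$ be the probability that a vertex chosen uniformly at random from the set of all $n\cdot n!$ vertices of all decreasing binary trees on $[n]$ is balanced. Then the sequence $P_1,P_2,\dots$ is weakly decreasing, i.e. $P_n\ge P_{n+1}$ for all $n\ge 1$.
   Context: A decreasing binary tree on vertex set $[n]=\{1,2,\dots,n\}$ is a rooted binary plane tree whose vertices are bijectively labeled by $[n]$, in which every vertex has a smaller label than its parent, every vertex has at most two children, and every child is designated either a left child or a right child of its parent (a vertex has at most one left child and at most one right child), even if it is the only child of its parent. There are $n!$ such trees on $[n]$. A leaf is a vertex with no children. A vertex $v$ of a rooted tree is called balanced if all descending paths from $v$ to a leaf have the same length (number of edges); that common length is the rank of $v$. In particular leaves are balanced, of rank $0$. *)

theory Defs
  imports "HOL-Library.Tree" "HOL-Probability.Probability"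
begin

text \<open>
  Binary plane trees are rendered by the library type \<open>'a tree\<close>. Its constructor \<open>\<langle>\<rangle>\<close> is the
  empty tree and not a vertex: the vertices are the inner nodes, and a side on which
  a vertex has no child carries \<open>\<langle>\<rangle>\<close>. All trees below have pairwise distinct labels, so that a
  vertex is identified with its label.
\<close>

definition children :: "'a tree \<Rightarrow> 'a \<Rightarrow> 'a set" where
  "children t u = {v. \<exists>l r l' r'. \<langle>l, u, r\<rangle> \<in> subtrees t \<and>
                        (l = \<langle>l', v, r'\<rangle> \<or> r = \<langle>l', v, r'\<rangle>)}"

definition decreasing_binary_trees :: "nat \<Rightarrow> nat tree set" where
  "decreasing_binary_trees n =
     {t. distinct (inorder t) \<and> set_tree t = {1..n} \<and>
         (\<forall>u \<in> set_tree t. \<forall>v \<in> children t u. v < u)}"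

definition is_leaf_vertex :: "'a tree \<Rightarrow> 'a \<Rightarrow> bool" where
  "is_leaf_vertex t v \<longleftrightarrow> v \<in> set_tree t \<and> children t v = {}"

text \<open>A path is given by its list of vertices; its number of edges is \<open>length p - 1\<close>.\<close>

definition descending_paths_to_leaf :: "'a tree \<Rightarrow> 'a \<Rightarrow> 'a list set" where
  "descending_paths_to_leaf t v =
     {p. p \<noteq> [] \<and> hd p = v \<and> successively (\<lambda>u w. w \<in> children t u) p \<and>
         is_leaf_vertex t (last p)}"

definition balanced_vertex :: "'a tree \<Rightarrow> 'a \<Rightarrow> bool" where
  "balanced_vertex t v \<longleftrightarrow>
     (\<forall>p \<in> descending_paths_to_leaf t v. \<forall>q \<in> descending_paths_to_leaf t v.
        length p - 1 = length q - 1)"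

definition tree_vertices :: "nat \<Rightarrow> (nat tree \<times> nat) set" where
  "tree_vertices n = (SIGMA t : decreasing_binary_trees n. set_tree t)"

definition balanced_probability :: "nat \<Rightarrow> real" where
  "balanced_probability n =
     measure_pmf.prob (pmf_of_set (tree_vertices n)) {(t, v). balanced_vertex t v}"

text \<open>
  The uniform distribution \<open>pmf_of_set\<close> is meaningful only on finite nonempty sets;
  this is the case here.
\<close>

lemma finite_trees_size_le:
  assumes "finite A"
  shows "finite {t. set_tree t \<subseteq> A \<and> size t \<le> n}"
proof (induction n)
  case 0
  have "{t. set_tree t \<subseteq> A \<and> size t \<le> 0} \<subseteq> {\<langle>\<rangle>}" by auto
  then show ?case using finite_subset by blast
next
  case (Suc n)
  let ?S = "{t. set_tree t \<subseteq> A \<and> size t \<le> n}"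
  have "{t. set_tree t \<subseteq> A \<and> size t \<le> Suc n} \<subseteq>
          insert \<langle>\<rangle> ((\<lambda>(l, a, r). \<langle>l, a, r\<rangle>) ` (?S \<times> A \<times> ?S))"
  proof
    fix t assume t: "t \<in> {t. set_tree t \<subseteq> A \<and> size t \<le> Suc n}"
    show "t \<in> insert \<langle>\<rangle> ((\<lambda>(l, a, r). \<langle>l, a, r\<rangle>) ` (?S \<times> A \<times> ?S))"
    proof (cases t)
      case Leaf
      then show ?thesis by simp
    next
      case (Node l a r)
      then have "(l, a, r) \<in> ?S \<times> A \<times> ?S" using t by auto
      then show ?thesis using Node by (intro insertI2 image_eqI[where x = "(l, a, r)"]) auto
    qed
  qed
  moreover have "finite (insert \<langle>\<rangle> ((\<lambda>(l, a, r). \<langle>l, a, r\<rangle>) ` (?S \<times> A \<times> ?S)))"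
    using Suc assms by simp
  ultimately show ?case using finite_subset by blast
qed

lemma finite_decreasing_binary_trees: "finite (decreasing_binary_trees n)"
proof (rule finite_subset)
  show "decreasing_binary_trees n \<subseteq> {t. set_tree t \<subseteq> {1..n} \<and> size t \<le> n}"
  proof
    fix t assume "t \<in> decreasing_binary_trees n"
    then have "distinct (inorder t)" "set_tree t = {1..n}"
      by (simp_all add: decreasing_binary_trees_def)
    moreover from this have "size t = n"
      by (metis card_atLeastAtMost diff_Suc_1 distinct_card length_inorder set_inorder)
    ultimately show "t \<in> {t. set_tree t \<subseteq> {1..n} \<and> size t \<le> n}" by simp
  qed
qed (simp add: finite_trees_size_le)

lemma finite_tree_vertices: "finite (tree_vertices n)"
  by (simp add: tree_vertices_def finite_decreasing_binary_trees)

lemma decreasing_binary_trees_nonempty: "decreasing_binary_trees n \<noteq> {}"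
proof (induction n)
  case 0
  have "\<langle>\<rangle> \<in> decreasing_binary_trees 0" by (simp add: decreasing_binary_trees_def)
  then show ?case by blast
next
  case (Suc n)
  then obtain t where t: "distinct (inorder t)" "set_tree t = {1..n}"
      "\<forall>u \<in> set_tree t. \<forall>v \<in> children t u. v < u"
    by (auto simp: decreasing_binary_trees_def)
  have sub: "\<And>l u r. \<langle>l, u, r\<rangle> \<in> subtrees t \<Longrightarrow> u \<in> set_tree t"
    by (induction t) auto
  have "v < u" if uv: "v \<in> children \<langle>t, Suc n, \<langle>\<rangle>\<rangle> u" for u v
  proof -
    from uv obtain l r l' r' where
      *: "\<langle>l, u, r\<rangle> \<in> subtrees \<langle>t, Suc n, \<langle>\<rangle>\<rangle>" "l = \<langle>l', v, r'\<rangle> \<or> r = \<langle>l', v, r'\<rangle>"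
      by (auto simp: children_def)
    show ?thesis
    proof (cases "\<langle>l, u, r\<rangle> \<in> subtrees t")
      case True
      then have "v \<in> children t u" using *(2) by (auto simp: children_def)
      then show ?thesis using t(3) sub[OF True] by blast
    next
      case False
      then have "u = Suc n" "t = \<langle>l', v, r'\<rangle>" using * by auto
      then have "v \<in> {1..n}" using t(2) by (metis insertI1 tree.set(2) Un_iff)
      then show ?thesis using \<open>u = Suc n\<close> by simp
    qed
  qed
  then have "\<langle>t, Suc n, \<langle>\<rangle>\<rangle> \<in> decreasing_binary_trees (Suc n)"
    using t by (auto simp: decreasing_binary_trees_def)
  then show ?case by blast
qed

lemma tree_vertices_nonempty: "n \<ge> 1 \<Longrightarrow> tree_vertices n \<noteq> {}"
  using decreasing_binary_trees_nonempty[of n]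
  by (fastforce simp: tree_vertices_def decreasing_binary_trees_def)

end

theory Submission
  imports Defs
begin

text \<open>
  Let \<open>A\<^sub>n\<close> be the mean number of balanced vertices of a decreasing binary tree on \<open>n\<close> labels and
  \<open>b\<^sub>n\<close> the probability that its root is balanced, so that \<open>P\<^sub>n = A\<^sub>n / n\<close>. The largest label sits at
  the root. The remaining \<open>n - 1\<close> labels are distributed over the two subtrees, the size of the left
  one is uniform on \<open>{0..n-1}\<close>, and given the label sets the subtrees are independent
  (\<open>sum_decreasing_trees_on\<close>). With \<open>q\<^sub>n = n b\<^sub>n\<close> this gives \<open>n A\<^sub>n = 2 (A\<^sub>0 + \<dots> + A\<^bsub>n-1\<^esub>) + q\<^sub>n\<close>;
  subtracting two consecutive instances, \<open>P\<^bsub>n+1\<^esub> \<le> P\<^sub>n\<close> becomes equivalent to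
  \<open>q\<^bsub>n+1\<^esub> - q\<^sub>n \<le> P\<^sub>n\<close>.

  The right-hand side is large: already the recurrence with the nonnegative terms \<open>q\<^sub>n\<close> dropped,
  started from the exact values up to \<open>A\<^sub>4 = 7/2\<close>, yields \<open>P\<^sub>n \<ge> 19/30\<close> (\<open>mean_balanced_lower\<close>).

  The left-hand side is small because a large tree rarely has a balanced root: either there is a
  single subtree, or two independent subtrees must have the same rank. Up to \<open>n = 7\<close> the numbers \<open>q\<^sub>n\<close>
  are computed, and \<open>q\<^sub>n \<le> 19/30\<close> for \<open>n \<ge> 8\<close> follows by induction (\<open>root_weight_le\<close>). In that
  induction the event of a single subtree costs \<open>2 b\<^bsub>n-1\<^esub>\<close>; when one subtree has at most
  three vertices, its rank is at most \<open>2\<close>, and a tree of small rank has few vertices; and the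
  probabilities of equal ranks for subtrees of sizes \<open>i\<close> and \<open>n - 1 - i\<close> with \<open>4 \<le> i \<le> n - 5\<close>
  are bounded, through \<open>2 x y \<le> x\<^sup>2 + y\<^sup>2\<close>, by the probabilities that two independent trees
  of the same size have balanced roots of the same rank. These are at most \<open>b\<^sub>i\<^sup>2\<close>, which is of
  order \<open>i\<^sup>-\<^sup>2\<close> by the induction hypothesis, so that their sum stays bounded by a small constant.
\<close>

section \<open>Balanced vertices by recursion on the tree\<close>

text \<open>
  At most one vertex: the child, if any, that a subtree contributes to its parent.
\<close>

fun root_labels :: "'a tree \<Rightarrow> 'a set" where
  "root_labels \<langle>\<rangle> = {}"
| "root_labels \<langle>l, a, r\<rangle> = {a}"

lemma in_root_labels: "v \<in> root_labels t \<longleftrightarrow> (\<exists>l r. t = \<langle>l, v, r\<rangle>)"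
  by (cases t) auto

lemma root_labels_subset: "root_labels t \<subseteq> set_tree t"
  by (cases t) auto

lemma subtree_root_in_set: "\<langle>l, u, r\<rangle> \<in> subtrees t \<Longrightarrow> u \<in> set_tree t"
  by (induction t) auto

lemma subtree_set_subset: "s \<in> subtrees t \<Longrightarrow> set_tree s \<subseteq> set_tree t"
  by (induction t) auto

lemma in_children_iff:
  "v \<in> children t u \<longleftrightarrow>
     (\<exists>l r. \<langle>l, u, r\<rangle> \<in> subtrees t \<and> v \<in> root_labels l \<union> root_labels r)"
  unfolding children_def Un_iff in_root_labels by blast

lemma children_subset: "children t u \<subseteq> set_tree t"
proof
  fix v assume "v \<in> children t u"
  then obtain l r where "\<langle>l, u, r\<rangle> \<in> subtrees t" and v: "v \<in> root_labels l \<union> root_labels r"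
    unfolding in_children_iff by blast
  then have "set_tree \<langle>l, u, r\<rangle> \<subseteq> set_tree t" using subtree_set_subset by blast
  then show "v \<in> set_tree t"
    using v root_labels_subset[of l] root_labels_subset[of r] by auto
qed

lemma children_outside: "u \<notin> set_tree t \<Longrightarrow> children t u = {}"
  unfolding children_def using subtree_root_in_set[of _ u _ t] by blast

lemma children_Node:
  "children \<langle>l, a, r\<rangle> u =
     (if u = a then root_labels l \<union> root_labels r else {}) \<union> children l u \<union> children r u"
  unfolding set_eq_iff in_children_iff Un_iff by auto

definition unique_labels :: "'a tree \<Rightarrow> bool" where
  "unique_labels t \<longleftrightarrow> distinct (inorder t)"

lemma unique_labels_simps [simp]:
  "unique_labels \<langle>\<rangle>"
  "unique_labels \<langle>l, a, r\<rangle> \<longleftrightarrow> unique_labels l \<and> unique_labels r \<and> a \<notin> set_tree l \<and>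
     a \<notin> set_tree r \<and> set_tree l \<inter> set_tree r = {}"
  by (auto simp: unique_labels_def)

lemma children_root:
  assumes "unique_labels \<langle>l, a, r\<rangle>"
  shows "children \<langle>l, a, r\<rangle> a = root_labels l \<union> root_labels r"
  using assms by (simp add: children_Node children_outside)

lemma children_left:
  assumes "unique_labels \<langle>l, a, r\<rangle>" "u \<in> set_tree l"
  shows "children \<langle>l, a, r\<rangle> u = children l u"
proof -
  have "u \<notin> set_tree r" "u \<noteq> a" using assms by auto
  then show ?thesis by (simp add: children_Node children_outside)
qed

lemma children_right:
  assumes "unique_labels \<langle>l, a, r\<rangle>" "u \<in> set_tree r"
  shows "children \<langle>l, a, r\<rangle> u = children r u"
proof -
  have "u \<notin> set_tree l" "u \<noteq> a" using assms by auto
  then show ?thesis by (simp add: children_Node children_outside)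
qed

lemma Cons_in_descending_paths:
  "u # p \<in> descending_paths_to_leaf t v \<longleftrightarrow>
     u = v \<and> (if p = [] then is_leaf_vertex t v
              else hd p \<in> children t v \<and> p \<in> descending_paths_to_leaf t (hd p))"
  by (cases p) (auto simp: descending_paths_to_leaf_def)

lemma Nil_notin_descending_paths: "[] \<notin> descending_paths_to_leaf t v"
  by (simp add: descending_paths_to_leaf_def)

text \<open>
  A descending path never leaves the subtree in which it starts. Hence whether a vertex is balanced
  depends only on the subtree below it.
\<close>

lemma descending_paths_cong:
  assumes "\<And>u. u \<in> set_tree s \<Longrightarrow> children t u = children s u"
      and "set_tree s \<subseteq> set_tree t" and "v \<in> set_tree s"
  shows "descending_paths_to_leaf t v = descending_paths_to_leaf s v"
proof -
  have "p \<in> descending_paths_to_leaf t v \<longleftrightarrow> p \<in> descending_paths_to_leaf s v" for p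
    using assms(3)
  proof (induction p arbitrary: v)
    case Nil
    then show ?case by (simp add: Nil_notin_descending_paths)
  next
    case (Cons u p)
    have "is_leaf_vertex t v = is_leaf_vertex s v"
      using Cons.prems assms by (auto simp: is_leaf_vertex_def)
    moreover have "hd p \<in> children s v \<Longrightarrow> hd p \<in> set_tree s"
      using children_subset by fast
    ultimately show ?case
      using Cons assms(1) by (auto simp: Cons_in_descending_paths)
  qed
  then show ?thesis by blast
qed

lemma descending_paths_left:
  assumes "unique_labels \<langle>l, a, r\<rangle>" "v \<in> set_tree l"
  shows "descending_paths_to_leaf \<langle>l, a, r\<rangle> v = descending_paths_to_leaf l v"
  using assms by (intro descending_paths_cong) (auto simp: children_left)

lemma descending_paths_right:
  assumes "unique_labels \<langle>l, a, r\<rangle>" "v \<in> set_tree r"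
  shows "descending_paths_to_leaf \<langle>l, a, r\<rangle> v = descending_paths_to_leaf r v"
  using assms by (intro descending_paths_cong) (auto simp: children_right)

text \<open>
  The descending paths from the root to a leaf, by structural recursion. The empty tree has none;
  this makes an absent subtree impose no condition on path lengths.
\<close>

fun root_paths :: "'a tree \<Rightarrow> 'a list set" where
  "root_paths \<langle>\<rangle> = {}"
| "root_paths \<langle>l, a, r\<rangle> =
     (if l = \<langle>\<rangle> \<and> r = \<langle>\<rangle> then {[a]} else (#) a ` (root_paths l \<union> root_paths r))"

lemma descending_paths_root:
  assumes "unique_labels t" "v \<in> root_labels t"
  shows "descending_paths_to_leaf t v = root_paths t"
  using assms
proof (induction t arbitrary: v)
  case Leaf
  then show ?case by simp
next
  case (Node l a r)
  have v: "v = a" using Node.prems by simp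
  have cl: "descending_paths_to_leaf \<langle>l, a, r\<rangle> w = root_paths l" if "w \<in> root_labels l" for w
  proof -
    have "w \<in> set_tree l" using that root_labels_subset by fast
    then show ?thesis
      using descending_paths_left[OF Node.prems(1)] Node.IH(1)[OF _ that] Node.prems(1) by simp
  qed
  have cr: "descending_paths_to_leaf \<langle>l, a, r\<rangle> w = root_paths r" if "w \<in> root_labels r" for w
  proof -
    have "w \<in> set_tree r" using that root_labels_subset by fast
    then show ?thesis
      using descending_paths_right[OF Node.prems(1)] Node.IH(2)[OF _ that] Node.prems(1) by simp
  qed
  have hd_root: "hd p \<in> root_labels s \<and> p \<noteq> []" if "p \<in> root_paths s" for p :: "'a list" and s
    using that by (cases s) (auto split: if_splits)
  have ch: "children \<langle>l, a, r\<rangle> a = root_labels l \<union> root_labels r"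
    using Node.prems by (intro children_root)
  have leaf: "is_leaf_vertex \<langle>l, a, r\<rangle> a \<longleftrightarrow> l = \<langle>\<rangle> \<and> r = \<langle>\<rangle>"
    unfolding is_leaf_vertex_def ch by (cases l; cases r) auto
  have "p \<in> descending_paths_to_leaf \<langle>l, a, r\<rangle> a \<longleftrightarrow> p \<in> root_paths \<langle>l, a, r\<rangle>" for p
  proof (cases p)
    case Nil
    then show ?thesis by (auto simp: Nil_notin_descending_paths)
  next
    case (Cons u q)
    show ?thesis
    proof (cases "q = []")
      case True
      have "[] \<notin> root_paths l \<union> root_paths r" using hd_root by blast
      then show ?thesis
        using leaf unfolding Cons True Cons_in_descending_paths by (simp add: image_iff)
    next
      case False
      have step: "(hd q \<in> root_labels l \<union> root_labels r \<and>
               q \<in> descending_paths_to_leaf \<langle>l, a, r\<rangle> (hd q)) \<longleftrightarrow>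
             q \<in> root_paths l \<union> root_paths r"
        using cl[of "hd q"] cr[of "hd q"] hd_root[of q l] hd_root[of q r] by fast
      then show ?thesis
        unfolding Cons Cons_in_descending_paths using False ch by (simp add: image_iff)
    qed
  qed
  then show ?case unfolding v by blast
qed

text \<open>
  The root is balanced and has rank \<open>k\<close>. Whether this holds depends on the shape of the tree alone,
  and the two subtrees enter through separate conditions, which is what makes the probability of this
  event satisfy a convolution recurrence.
\<close>

fun has_rank :: "nat \<Rightarrow> 'a tree \<Rightarrow> bool" where
  "has_rank k \<langle>\<rangle> \<longleftrightarrow> False"
| "has_rank 0 \<langle>l, a, r\<rangle> \<longleftrightarrow> l = \<langle>\<rangle> \<and> r = \<langle>\<rangle>"
| "has_rank (Suc k) \<langle>l, a, r\<rangle> \<longleftrightarrow>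
     (l = \<langle>\<rangle> \<or> has_rank k l) \<and> (r = \<langle>\<rangle> \<or> has_rank k r) \<and> (l \<noteq> \<langle>\<rangle> \<or> r \<noteq> \<langle>\<rangle>)"

lemma root_paths_nonempty: "t \<noteq> \<langle>\<rangle> \<Longrightarrow> root_paths t \<noteq> {}"
proof (induction t)
  case (Node l a r)
  then show ?case by (cases "l = \<langle>\<rangle>"; cases "r = \<langle>\<rangle>") auto
qed simp

lemma Nil_notin_root_paths: "[] \<notin> root_paths t"
  by (cases t) auto

lemma has_rank_iff_root_paths:
  "has_rank k t \<longleftrightarrow> t \<noteq> \<langle>\<rangle> \<and> (\<forall>p \<in> root_paths t. length p = Suc k)"
proof (induction t arbitrary: k)
  case Leaf
  then show ?case by simp
next
  case (Node l a r)
  show ?case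
  proof (cases "l = \<langle>\<rangle> \<and> r = \<langle>\<rangle>")
    case True
    then show ?thesis by (cases k) auto
  next
    case inner: False
    then have paths: "root_paths \<langle>l, a, r\<rangle> = (#) a ` (root_paths l \<union> root_paths r)"
      by simp
    show ?thesis
    proof (cases k)
      case 0
      \<comment> \<open>An inner root lies above a whole path of a subtree, so its paths have at least one edge.\<close>
      obtain p where "p \<in> root_paths l \<union> root_paths r"
        using inner root_paths_nonempty[of l] root_paths_nonempty[of r] by blast
      moreover from this have "p \<noteq> []"
        using Nil_notin_root_paths[of l] Nil_notin_root_paths[of r] by blast
      ultimately show ?thesis using 0 inner unfolding paths by auto
    next
      case (Suc j)
      have empty: "s = \<langle>\<rangle> \<or> has_rank j s \<longleftrightarrow> (\<forall>p \<in> root_paths s. length p = Suc j)"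
        if "\<And>k. has_rank k s \<longleftrightarrow> s \<noteq> \<langle>\<rangle> \<and> (\<forall>p \<in> root_paths s. length p = Suc k)"
        for s :: "'a tree"
        unfolding that by (cases s) simp_all
      have "has_rank k \<langle>l, a, r\<rangle> \<longleftrightarrow> (l = \<langle>\<rangle> \<or> has_rank j l) \<and> (r = \<langle>\<rangle> \<or> has_rank j r)"
        using Suc inner by simp
      also have "\<dots> \<longleftrightarrow> (\<forall>p \<in> root_paths l \<union> root_paths r. length p = Suc j)"
        unfolding empty[OF Node.IH(1)] empty[OF Node.IH(2)] by blast
      finally show ?thesis unfolding paths Suc by simp
    qed
  qed
qed

lemma balanced_root_iff:
  assumes "unique_labels \<langle>l, a, r\<rangle>"
  shows "balanced_vertex \<langle>l, a, r\<rangle> a \<longleftrightarrow> (\<exists>k. has_rank k \<langle>l, a, r\<rangle>)"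
proof -
  let ?t = "\<langle>l, a, r\<rangle>"
  have paths: "descending_paths_to_leaf ?t a = root_paths ?t"
    by (rule descending_paths_root[OF assms]) (simp only: root_labels.simps singleton_iff)
  obtain p where p: "p \<in> root_paths ?t" using root_paths_nonempty[of ?t] by blast
  have pos: "length q = Suc (length q - 1)" if "q \<in> root_paths ?t" for q
  proof -
    have "q \<noteq> []" using that Nil_notin_root_paths by blast
    then show ?thesis by (cases q) simp_all
  qed
  have "(\<forall>p \<in> root_paths ?t. \<forall>q \<in> root_paths ?t. length p - 1 = length q - 1) \<longleftrightarrow>
      (\<exists>k. \<forall>q \<in> root_paths ?t. length q = Suc k)"
  proof
    assume "\<forall>p \<in> root_paths ?t. \<forall>q \<in> root_paths ?t. length p - 1 = length q - 1"
    then have "length q = Suc (length p - 1)" if "q \<in> root_paths ?t" for q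
      using p pos[OF that] that by metis
    then show "\<exists>k. \<forall>q \<in> root_paths ?t. length q = Suc k" by blast
  next
    assume "\<exists>k. \<forall>q \<in> root_paths ?t. length q = Suc k"
    then obtain k where "length q = Suc k" if "q \<in> root_paths ?t" for q by blast
    then show "\<forall>p \<in> root_paths ?t. \<forall>q \<in> root_paths ?t. length p - 1 = length q - 1"
      by simp
  qed
  then show ?thesis
    unfolding has_rank_iff_root_paths balanced_vertex_def paths by blast
qed

fun balanced_count :: "'a tree \<Rightarrow> nat" where
  "balanced_count \<langle>\<rangle> = 0"
| "balanced_count \<langle>l, a, r\<rangle> =
     balanced_count l + balanced_count r + of_bool (\<exists>k. has_rank k \<langle>l, a, r\<rangle>)"

lemma card_balanced_vertices:
  assumes "unique_labels t"
  shows "card {v \<in> set_tree t. balanced_vertex t v} = balanced_count t"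
  using assms
proof (induction t)
  case Leaf
  then show ?case by simp
next
  case (Node l a r)
  let ?t = "\<langle>l, a, r\<rangle>"
  have L: "balanced_vertex ?t v \<longleftrightarrow> balanced_vertex l v" if "v \<in> set_tree l" for v
    using that Node.prems by (simp add: balanced_vertex_def descending_paths_left)
  have R: "balanced_vertex ?t v \<longleftrightarrow> balanced_vertex r v" if "v \<in> set_tree r" for v
    using that Node.prems by (simp add: balanced_vertex_def descending_paths_right)
  let ?A = "{v \<in> set_tree l. balanced_vertex l v}" and ?B = "{v \<in> set_tree r. balanced_vertex r v}"
    and ?C = "{v. v = a \<and> balanced_vertex ?t a}"
  have "{v \<in> set_tree ?t. balanced_vertex ?t v} = (?A \<union> ?B) \<union> ?C"
    using L R by auto
  also have "card \<dots> = card ?A + card ?B + card ?C"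
  proof -
    have "card ((?A \<union> ?B) \<union> ?C) = card (?A \<union> ?B) + card ?C"
      using Node.prems by (intro card_Un_disjoint) auto
    moreover have "card (?A \<union> ?B) = card ?A + card ?B"
      using Node.prems by (intro card_Un_disjoint) auto
    ultimately show ?thesis by simp
  qed
  also have "card ?C = of_bool (\<exists>k. has_rank k ?t)"
    unfolding balanced_root_iff[OF Node.prems] by simp
  finally show ?case using Node by simp
qed

lemma has_rank_unique:
  assumes "has_rank j t" "has_rank k t"
  shows "j = k"
proof -
  obtain p where "p \<in> root_paths t"
    using assms(1) root_paths_nonempty[of t] unfolding has_rank_iff_root_paths by blast
  then have "length p = Suc j" "length p = Suc k"
    using assms unfolding has_rank_iff_root_paths by blast+
  then show ?thesis by simp
qed

lemma has_rank_less_size: "has_rank k t \<Longrightarrow> k < size t"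
proof (induction k t rule: has_rank.induct)
  case (3 k l a r)
  then show ?case by (cases "l = \<langle>\<rangle>") auto
qed auto

section \<open>Decreasing trees split at the largest label\<close>

text \<open>
  Comparing a vertex with all its descendants, rather than with its children only, shows directly
  that the root carries the largest label.
\<close>

fun decreasing :: "'a :: linorder tree \<Rightarrow> bool" where
  "decreasing \<langle>\<rangle> \<longleftrightarrow> True"
| "decreasing \<langle>l, a, r\<rangle> \<longleftrightarrow> decreasing l \<and> decreasing r \<and> (\<forall>v \<in> set_tree l \<union> set_tree r. v < a)"

lemma decreasing_iff_children:
  assumes "unique_labels t"
  shows "decreasing t \<longleftrightarrow> (\<forall>u \<in> set_tree t. \<forall>v \<in> children t u. v < u)"
  using assms
proof (induction t)
  case Leaf
  then show ?case by simp
next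
  case (Node l a r)
  have root_max: "v < a"
    if "decreasing s" "root_labels s \<subseteq> {..<a}" "v \<in> set_tree s" for v and s :: "'a tree"
    using that by (cases s) (auto intro: order.strict_trans)
  have "(\<forall>u \<in> set_tree \<langle>l, a, r\<rangle>. \<forall>v \<in> children \<langle>l, a, r\<rangle> u. v < u) \<longleftrightarrow>
      (\<forall>v \<in> root_labels l \<union> root_labels r. v < a) \<and>
      (\<forall>u \<in> set_tree l. \<forall>v \<in> children l u. v < u) \<and> (\<forall>u \<in> set_tree r. \<forall>v \<in> children r u. v < u)"
    using children_root[OF Node.prems] children_left[OF Node.prems] children_right[OF Node.prems]
    by auto
  also have "\<dots> \<longleftrightarrow> (\<forall>v \<in> root_labels l \<union> root_labels r. v < a) \<and> decreasing l \<and> decreasing r"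
    using Node by simp
  also have "\<dots> \<longleftrightarrow> decreasing \<langle>l, a, r\<rangle>"
    using root_max[of l] root_max[of r] root_labels_subset[of l] root_labels_subset[of r]
    by (auto simp: subset_iff)
  finally show ?case by simp
qed

text \<open>
  The subtrees of a decreasing tree on \<open>{1..n}\<close> are decreasing trees on arbitrary label sets. Working
  with an arbitrary set from the start avoids relabelling: the averages below are shown to depend
  on its cardinality only.
\<close>

definition decreasing_trees_on :: "'a :: linorder set \<Rightarrow> 'a tree set" where
  "decreasing_trees_on S = {t. unique_labels t \<and> decreasing t \<and> set_tree t = S}"

lemma decreasing_binary_trees_eq: "decreasing_binary_trees n = decreasing_trees_on {1..n}"
  unfolding decreasing_binary_trees_def decreasing_trees_on_def
  using decreasing_iff_children by (auto simp: unique_labels_def)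

lemma decreasing_trees_on_empty: "decreasing_trees_on {} = {\<langle>\<rangle>}"
  by (auto simp: decreasing_trees_on_def)

lemma size_decreasing_trees_on: "t \<in> decreasing_trees_on S \<Longrightarrow> size t = card S"
  unfolding decreasing_trees_on_def unique_labels_def
  using distinct_card[of "inorder t"] by simp

lemma finite_decreasing_trees_on:
  assumes "finite S" shows "finite (decreasing_trees_on S)"
proof (rule finite_subset)
  show "decreasing_trees_on S \<subseteq> {t. set_tree t \<subseteq> S \<and> size t \<le> card S}"
    using size_decreasing_trees_on eq_imp_le by (fastforce simp: decreasing_trees_on_def)
qed (use assms finite_trees_size_le in auto)

text \<open>
  The root must carry the largest label, and below it any two decreasing trees on complementary
  sets of the other labels may be placed. Every average in this development is computed through this
  decomposition.
\<close>

lemma decreasing_trees_on_split: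
  fixes S :: "'a :: linorder set"
  assumes "finite S" "S \<noteq> {}"
  defines "R \<equiv> S - {Max S}"
  shows "bij_betw (\<lambda>(L, l, r). \<langle>l, Max S, r\<rangle>)
           (SIGMA L : Pow R. decreasing_trees_on L \<times> decreasing_trees_on (R - L))
           (decreasing_trees_on S)"
proof -
  have mx: "Max S \<in> S" "\<And>x. x \<in> R \<Longrightarrow> x < Max S"
    using assms by (auto simp: order_less_le)
  let ?X = "SIGMA L : Pow R. decreasing_trees_on L \<times> decreasing_trees_on (R - L)"
  have "inj_on (\<lambda>(L, l, r). \<langle>l, Max S, r\<rangle>) ?X"
    by (auto simp: inj_on_def decreasing_trees_on_def)
  moreover have "\<langle>l, Max S, r\<rangle> \<in> decreasing_trees_on S"
    if "L \<subseteq> R" "l \<in> decreasing_trees_on L" "r \<in> decreasing_trees_on (R - L)" for L l r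
  proof -
    have "set_tree l \<union> set_tree r = R" "set_tree l \<inter> set_tree r = {}"
      using that by (auto simp: decreasing_trees_on_def)
    moreover from this have "Max S \<notin> set_tree l \<union> set_tree r" "insert (Max S) R = S"
      using mx by (auto simp: R_def)
    ultimately show ?thesis
      using that mx(2) unfolding decreasing_trees_on_def by auto
  qed
  then have "(\<lambda>(L, l, r). \<langle>l, Max S, r\<rangle>) ` ?X \<subseteq> decreasing_trees_on S"
    by auto
  moreover have "t \<in> (\<lambda>(L, l, r). \<langle>l, Max S, r\<rangle>) ` ?X" if t: "t \<in> decreasing_trees_on S" for t
  proof (cases t)
    case Leaf
    then show ?thesis using t assms by (simp add: decreasing_trees_on_def)
  next
    case (Node l a r)
    have S: "S = insert a (set_tree l \<union> set_tree r)"
      and lt: "\<forall>v \<in> set_tree l \<union> set_tree r. v < a"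
      using t Node by (auto simp: decreasing_trees_on_def)
    then have a: "a = Max S"
      using assms(1) by (intro Max_eqI[symmetric]) (auto intro: less_imp_le)
    have "R = set_tree l \<union> set_tree r"
      using S lt unfolding R_def a[symmetric] by auto
    then have "(set_tree l, l, r) \<in> ?X"
      using t Node by (auto simp: decreasing_trees_on_def)
    then show ?thesis using Node a by (auto intro!: image_eqI)
  qed
  ultimately show ?thesis unfolding bij_betw_def by blast
qed

lemma sum_Pow_card:
  fixes g :: "nat \<Rightarrow> real"
  assumes "finite R"
  shows "(\<Sum>L \<in> Pow R. g (card L)) = (\<Sum>i\<le>card R. real (card R choose i) * g i)"
proof -
  have "(\<Sum>L \<in> Pow R. g (card L)) =
      (\<Sum>i\<le>card R. \<Sum>L \<in> {L \<in> Pow R. card L = i}. g (card L))"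
    using assms by (intro sum.group[symmetric]) (auto simp: card_mono)
  also have "\<dots> = (\<Sum>i\<le>card R. real (card R choose i) * g i)"
    using n_subsets[OF assms] by (intro sum.cong) auto
  finally show ?thesis .
qed

text \<open>
  The left subtree has a uniformly distributed size: if \<open>h i j\<close> is the mean of \<open>F\<close> over the trees with
  subtrees on two given label sets of sizes \<open>i\<close> and \<open>j\<close>, then the \<open>m choose i\<close> sets of size \<open>i\<close>
  contribute \<open>(m choose i) * i! * (m - i)! * h i (m - i) = m! * h i (m - i)\<close>, with the same weight for
  all \<open>i\<close>.
\<close>

lemma sum_decreasing_trees_on:
  fixes F :: "'a :: linorder tree \<Rightarrow> real"
  assumes "finite S" "card S = Suc m"
    and h: "\<And>L R. finite L \<Longrightarrow> finite R \<Longrightarrow> card L + card R = m \<Longrightarrow>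
      (\<Sum>l \<in> decreasing_trees_on L. \<Sum>r \<in> decreasing_trees_on R. F \<langle>l, Max S, r\<rangle>) =
        fact (card L) * fact (card R) * h (card L) (card R)"
  shows "(\<Sum>t \<in> decreasing_trees_on S. F t) = fact m * (\<Sum>i\<le>m. h i (m - i))"
proof -
  have ne: "S \<noteq> {}" using assms(2) by auto
  define R where "R = S - {Max S}"
  have R: "finite R" "card R = m"
    using assms ne by (auto simp: R_def)
  have "(\<Sum>t \<in> decreasing_trees_on S. F t) =
      (\<Sum>(L, l, r) \<in> (SIGMA L : Pow R. decreasing_trees_on L \<times> decreasing_trees_on (R - L)).
         F \<langle>l, Max S, r\<rangle>)"
    using sum.reindex_bij_betw[OF decreasing_trees_on_split[OF assms(1) ne], of F]
    by (simp add: R_def case_prod_unfold)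
  also have "\<dots> = (\<Sum>L \<in> Pow R. \<Sum>(l, r) \<in> decreasing_trees_on L \<times> decreasing_trees_on (R - L).
         F \<langle>l, Max S, r\<rangle>)"
    using R by (subst sum.Sigma)
      (auto intro!: finite_cartesian_product finite_decreasing_trees_on intro: finite_subset)
  also have "\<dots> = (\<Sum>L \<in> Pow R. \<Sum>l \<in> decreasing_trees_on L. \<Sum>r \<in> decreasing_trees_on (R - L).
         F \<langle>l, Max S, r\<rangle>)"
    by (simp add: sum.cartesian_product)
  also have "\<dots> = (\<Sum>L \<in> Pow R. fact (card L) * fact (m - card L) * h (card L) (m - card L))"
  proof (intro sum.cong refl)
    fix L assume "L \<in> Pow R"
    then have "finite L" "card (R - L) = m - card L" "card L \<le> m"
      using R finite_subset[of L R] by (auto simp: card_Diff_subset card_mono)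
    then show "(\<Sum>l \<in> decreasing_trees_on L. \<Sum>r \<in> decreasing_trees_on (R - L). F \<langle>l, Max S, r\<rangle>) =
        fact (card L) * fact (m - card L) * h (card L) (m - card L)"
      using h[of L "R - L"] R by simp
  qed
  also have "\<dots> = (\<Sum>i\<le>m. real (m choose i) * (fact i * fact (m - i) * h i (m - i)))"
    using sum_Pow_card[OF R(1), of "\<lambda>i. fact i * fact (m - i) * h i (m - i)"] R by simp
  also have "\<dots> = (\<Sum>i\<le>m. fact m * h i (m - i))"
  proof (intro sum.cong refl)
    fix i assume "i \<in> {..m}"
    then have "fact i * fact (m - i) * real (m choose i) = fact m"
      using binomial_fact_lemma[of i m] by (metis atMost_iff of_nat_fact of_nat_mult)
    then show "real (m choose i) * (fact i * fact (m - i) * h i (m - i)) = fact m * h i (m - i)"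
      by (metis mult.assoc mult.commute)
  qed
  finally show ?thesis by (simp add: sum_distrib_left)
qed

section \<open>Recurrences for the averages over all decreasing trees\<close>

text \<open>
  The probability that a decreasing tree with \<open>n\<close> vertices has a balanced root of rank \<open>k\<close>, as
  \<open>sum_has_rank\<close> confirms. The term \<open>2 * rank_prob k m\<close> accounts for a root with one child, the
  convolution for a root with two children; the empty subtrees drop out of the latter because
  \<open>rank_prob k 0 = 0\<close>.
\<close>

primrec rank_prob :: "nat \<Rightarrow> nat \<Rightarrow> real" where
  "rank_prob 0 n = of_bool (n = 1)"
| "rank_prob (Suc k) n = (case n of 0 \<Rightarrow> 0 | Suc m \<Rightarrow>
     (2 * rank_prob k m + (\<Sum>i\<le>m. rank_prob k i * rank_prob k (m - i))) / real (Suc m))"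

lemma rank_prob_0_right [simp]: "rank_prob k 0 = 0"
  by (cases k) auto

lemma rank_prob_Suc_Suc:
  "real (Suc m) * rank_prob (Suc k) (Suc m) =
     2 * rank_prob k m + (\<Sum>i\<le>m. rank_prob k i * rank_prob k (m - i))"
  by (simp add: rank_prob.simps)

declare rank_prob.simps [simp del]

lemma rank_prob_0_left: "rank_prob 0 n = of_bool (n = 1)"
  by (simp add: rank_prob.simps)

text \<open>
  The probability that the root is balanced. A path has fewer edges than the tree has vertices, so
  ranks below \<open>n\<close> suffice.
\<close>

definition balanced_prob :: "nat \<Rightarrow> real" where
  "balanced_prob n = (\<Sum>k<n. rank_prob k n)"

text \<open>
  The inhomogeneous term \<open>q\<^sub>n\<close> in the recurrence for the mean number of balanced vertices.
\<close>

definition root_weight :: "nat \<Rightarrow> real" where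
  "root_weight n = real n * balanced_prob n"

text \<open>
  The mean number of balanced vertices of a decreasing tree, as \<open>sum_balanced_count\<close> confirms: both
  subtrees have the same distribution, and the root contributes the probability that it is balanced.
\<close>

fun mean_balanced :: "nat \<Rightarrow> real" where
  "mean_balanced 0 = 0"
| "mean_balanced (Suc m) = 2 * (\<Sum>i\<le>m. mean_balanced i) / real (Suc m) + balanced_prob (Suc m)"

lemma mean_balanced_Suc:
  "real (Suc m) * mean_balanced (Suc m) = 2 * (\<Sum>i\<le>m. mean_balanced i) + root_weight (Suc m)"
  by (simp add: root_weight_def field_simps)

declare mean_balanced.simps [simp del]

lemma card_decreasing_trees_on:
  "finite S \<Longrightarrow> real (card (decreasing_trees_on S)) = fact (card S)"
proof (induction "card S" arbitrary: S rule: less_induct)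
  case less
  show ?case
  proof (cases "card S")
    case 0
    then show ?thesis using less.prems by (simp add: decreasing_trees_on_empty)
  next
    case (Suc m)
    have "(\<Sum>t \<in> decreasing_trees_on S. 1 :: real) = fact m * (\<Sum>i\<le>m. 1)"
      using less by (intro sum_decreasing_trees_on[OF less.prems Suc]) (simp add: Suc)
    then show ?thesis using Suc by (simp add: algebra_simps)
  qed
qed

lemma sum_is_Leaf:
  "(\<Sum>t \<in> decreasing_trees_on S. of_bool (t = \<langle>\<rangle>)) = (of_bool (S = {}) :: real)"
proof (cases "S = {}")
  case False
  then have "of_bool (t = \<langle>\<rangle>) = (0 :: real)" if "t \<in> decreasing_trees_on S" for t
    using that by (auto simp: decreasing_trees_on_def)
  then show ?thesis using False by simp
qed (simp add: decreasing_trees_on_empty)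

lemma sum_has_rank:
  "finite S \<Longrightarrow> (\<Sum>t \<in> decreasing_trees_on S. of_bool (has_rank k t)) =
     fact (card S) * rank_prob k (card S)"
proof (induction k arbitrary: S)
  case 0
  show ?case
  proof (cases "card S")
    case (Suc m)
    have "(\<Sum>t \<in> decreasing_trees_on S. of_bool (has_rank 0 t)) =
        fact m * (\<Sum>i\<le>m. of_bool (i = 0) * of_bool (m - i = 0) :: real)"
    proof (rule sum_decreasing_trees_on[OF "0.prems" Suc,
          where h = "\<lambda>i j. of_bool (i = 0) * of_bool (j = 0)"])
      fix L R :: "'a set"
      assume "finite L" "finite R"
      have "(\<Sum>l \<in> decreasing_trees_on L. \<Sum>r \<in> decreasing_trees_on R.
               of_bool (has_rank 0 \<langle>l, Max S, r\<rangle>)) =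
          (\<Sum>l \<in> decreasing_trees_on L. of_bool (l = \<langle>\<rangle>)) *
          (\<Sum>r \<in> decreasing_trees_on R. of_bool (r = \<langle>\<rangle>) :: real)"
        by (simp only: has_rank.simps of_bool_conj sum_product)
      then show "(\<Sum>l \<in> decreasing_trees_on L. \<Sum>r \<in> decreasing_trees_on R.
               of_bool (has_rank 0 \<langle>l, Max S, r\<rangle>)) =
          fact (card L) * fact (card R) * (of_bool (card L = 0) * of_bool (card R = 0) :: real)"
        using \<open>finite L\<close> \<open>finite R\<close> by (simp add: sum_is_Leaf)
    qed
    also have "(\<Sum>i\<le>m. of_bool (i = 0) * of_bool (m - i = 0)) = (of_bool (m = 0) :: real)"
      by (cases m) (auto intro: sum.neutral)
    finally show ?thesis using Suc by (cases m) (auto simp: rank_prob_0_left)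
  qed (use "0.prems" in \<open>simp add: decreasing_trees_on_empty\<close>)
next
  case (Suc k)
  show ?case
  proof (cases "card S")
    case card: (Suc m)
    let ?p = "rank_prob k"
    have "(\<Sum>t \<in> decreasing_trees_on S. of_bool (has_rank (Suc k) t)) =
        fact m * (\<Sum>i\<le>m. of_bool (i = 0) * ?p (m - i) + ?p i * of_bool (m - i = 0) + ?p i * ?p (m - i))"
    proof (rule sum_decreasing_trees_on[OF Suc.prems card,
          where h = "\<lambda>i j. of_bool (i = 0) * ?p j + ?p i * of_bool (j = 0) + ?p i * ?p j"])
      fix L R :: "'a set"
      assume LR: "finite L" "finite R"
      let ?e = "\<lambda>t. of_bool (t = \<langle>\<rangle>) :: real" and ?x = "\<lambda>t. of_bool (has_rank k t) :: real"
      \<comment> \<open>The root has only a right child, only a left child, or two children.\<close>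
      have ind: "of_bool (has_rank (Suc k) \<langle>l, Max S, r\<rangle>) = ?e l * ?x r + ?x l * ?e r + ?x l * ?x r"
        for l r
        by (cases l; cases r) auto
      have "(\<Sum>l \<in> decreasing_trees_on L. \<Sum>r \<in> decreasing_trees_on R.
               of_bool (has_rank (Suc k) \<langle>l, Max S, r\<rangle>)) =
          (\<Sum>l \<in> decreasing_trees_on L. ?e l) * (\<Sum>r \<in> decreasing_trees_on R. ?x r) +
          (\<Sum>l \<in> decreasing_trees_on L. ?x l) * (\<Sum>r \<in> decreasing_trees_on R. ?e r) +
          (\<Sum>l \<in> decreasing_trees_on L. ?x l) * (\<Sum>r \<in> decreasing_trees_on R. ?x r)"
        by (simp only: ind sum.distrib sum_product)
      also have "\<dots> = fact (card L) * fact (card R) * (of_bool (card L = 0) * ?p (card R) +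
          ?p (card L) * of_bool (card R = 0) + ?p (card L) * ?p (card R))"
        unfolding sum_is_Leaf Suc.IH[OF LR(1)] Suc.IH[OF LR(2)]
        using LR by (cases "L = {}"; cases "R = {}") (simp_all add: algebra_simps)
      finally show "(\<Sum>l \<in> decreasing_trees_on L. \<Sum>r \<in> decreasing_trees_on R.
               of_bool (has_rank (Suc k) \<langle>l, Max S, r\<rangle>)) =
          fact (card L) * fact (card R) * (of_bool (card L = 0) * ?p (card R) +
          ?p (card L) * of_bool (card R = 0) + ?p (card L) * ?p (card R))" .
    qed
    also have "(\<Sum>i\<le>m. of_bool (i = 0) * ?p (m - i) + ?p i * of_bool (m - i = 0) + ?p i * ?p (m - i)) =
        2 * ?p m + (\<Sum>i\<le>m. ?p i * ?p (m - i))"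
    proof -
      have "(\<Sum>i\<le>m. of_bool (i = 0) * ?p (m - i)) = (\<Sum>i\<le>m. if i = 0 then ?p (m - i) else 0)"
        by (intro sum.cong) auto
      moreover have "(\<Sum>i\<le>m. ?p i * of_bool (m - i = 0)) = (\<Sum>i\<le>m. if i = m then ?p i else 0)"
        by (intro sum.cong) auto
      ultimately show ?thesis by (simp add: sum.distrib)
    qed
    also have "\<dots> = real (Suc m) * rank_prob (Suc k) (Suc m)"
      by (rule rank_prob_Suc_Suc[symmetric])
    finally show ?thesis using card by (simp add: algebra_simps)
  qed (use Suc.prems in \<open>simp add: decreasing_trees_on_empty\<close>)
qed

lemma sum_balanced_root:
  assumes "finite S"
  shows "(\<Sum>t \<in> decreasing_trees_on S. of_bool (\<exists>k. has_rank k t)) =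
           fact (card S) * balanced_prob (card S)"
proof -
  have "of_bool (\<exists>k. has_rank k t) = (\<Sum>k<card S. of_bool (has_rank k t) :: real)"
    if t: "t \<in> decreasing_trees_on S" for t
  proof (cases "\<exists>k. has_rank k t")
    case True
    then obtain j where j: "has_rank j t" by blast
    then have "has_rank k t \<longleftrightarrow> k = j" for k using has_rank_unique by blast
    moreover have "j < card S"
      using has_rank_less_size[OF j] size_decreasing_trees_on[OF t] by simp
    ultimately show ?thesis by simp
  qed simp
  then have "(\<Sum>t \<in> decreasing_trees_on S. of_bool (\<exists>k. has_rank k t)) =
      (\<Sum>t \<in> decreasing_trees_on S. \<Sum>k<card S. of_bool (has_rank k t) :: real)"
    by (intro sum.cong) auto
  also have "\<dots> = (\<Sum>k<card S. \<Sum>t \<in> decreasing_trees_on S. of_bool (has_rank k t))"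
    by (rule sum.swap)
  also have "\<dots> = fact (card S) * balanced_prob (card S)"
    by (simp add: sum_has_rank[OF assms] balanced_prob_def sum_distrib_left)
  finally show ?thesis .
qed

lemma sum_balanced_count:
  "finite S \<Longrightarrow> (\<Sum>t \<in> decreasing_trees_on S. real (balanced_count t)) =
     fact (card S) * mean_balanced (card S)"
proof (induction "card S" arbitrary: S rule: less_induct)
  case less
  show ?case
  proof (cases "card S")
    case 0
    then show ?thesis
      using less.prems by (simp add: decreasing_trees_on_empty mean_balanced.simps)
  next
    case (Suc m)
    let ?A = mean_balanced
    define below :: "'a tree \<Rightarrow> real" where
      "below t = (case t of \<langle>\<rangle> \<Rightarrow> 0 | \<langle>l, a, r\<rangle> \<Rightarrow> real (balanced_count l) + real (balanced_count r))"
      for t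
    have "real (balanced_count t) = below t + of_bool (\<exists>k. has_rank k t)" for t
      by (cases t) (simp_all add: below_def)
    then have "(\<Sum>t \<in> decreasing_trees_on S. real (balanced_count t)) =
        (\<Sum>t \<in> decreasing_trees_on S. below t) + fact (Suc m) * balanced_prob (Suc m)"
      using sum_balanced_root[OF less.prems] Suc by (simp add: sum.distrib)
    also have "(\<Sum>t \<in> decreasing_trees_on S. below t) = fact m * (\<Sum>i\<le>m. ?A i + ?A (m - i))"
    proof (rule sum_decreasing_trees_on[OF less.prems Suc, where h = "\<lambda>i j. ?A i + ?A j"])
      fix L R :: "'a set"
      assume LR: "finite L" "finite R" "card L + card R = m"
      have "(\<Sum>l \<in> decreasing_trees_on L. \<Sum>r \<in> decreasing_trees_on R. below \<langle>l, Max S, r\<rangle>) =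
          real (card (decreasing_trees_on R)) * (\<Sum>l \<in> decreasing_trees_on L. real (balanced_count l)) +
          real (card (decreasing_trees_on L)) * (\<Sum>r \<in> decreasing_trees_on R. real (balanced_count r))"
        by (simp add: below_def sum.distrib flip: sum_distrib_left)
      also have "\<dots> = fact (card L) * fact (card R) * (?A (card L) + ?A (card R))"
        using less.hyps[of L] less.hyps[of R] LR Suc
        by (simp add: card_decreasing_trees_on algebra_simps)
      finally show "(\<Sum>l \<in> decreasing_trees_on L. \<Sum>r \<in> decreasing_trees_on R. below \<langle>l, Max S, r\<rangle>) =
          fact (card L) * fact (card R) * (?A (card L) + ?A (card R))" .
    qed
    also have "(\<Sum>i\<le>m. ?A i + ?A (m - i)) = 2 * (\<Sum>i\<le>m. ?A i)"
    proof -
      have "(\<Sum>i\<le>m. ?A (m - i)) = (\<Sum>i\<le>m. ?A i)"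
        by (intro sum.reindex_bij_witness[of _ "\<lambda>i. m - i" "\<lambda>i. m - i"]) auto
      then show ?thesis by (simp add: sum.distrib)
    qed
    also have "fact m * (2 * (\<Sum>i\<le>m. ?A i)) + fact (Suc m) * balanced_prob (Suc m) =
        fact m * (2 * (\<Sum>i\<le>m. ?A i) + root_weight (Suc m))"
      by (simp add: root_weight_def algebra_simps)
    also have "\<dots> = fact m * (real (Suc m) * ?A (Suc m))"
      by (simp only: mean_balanced_Suc)
    finally show ?thesis using Suc by (simp add: algebra_simps)
  qed
qed

lemma balanced_probability_eq:
  assumes "n \<ge> 1"
  shows "balanced_probability n = mean_balanced n / real n"
proof -
  let ?D = "decreasing_trees_on {1..n}"
  let ?bal = "{(t, v). balanced_vertex t v}"
  have fin: "finite ?D" by (simp add: finite_decreasing_trees_on)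
  have tv: "tree_vertices n = (SIGMA t : ?D. set_tree t)"
    by (simp add: tree_vertices_def decreasing_binary_trees_eq)
  have "card (set_tree t) = n" if "t \<in> ?D" for t
    using that by (auto simp: decreasing_trees_on_def)
  then have "card (tree_vertices n) = card ?D * n"
    unfolding tv using fin by (subst card_SigmaI) auto
  then have all: "real (card (tree_vertices n)) = fact n * real n"
    using card_decreasing_trees_on[of "{1..n}"] by simp
  have "tree_vertices n \<inter> ?bal = (SIGMA t : ?D. {v \<in> set_tree t. balanced_vertex t v})"
    unfolding tv by auto
  then have "card (tree_vertices n \<inter> ?bal) =
      (\<Sum>t \<in> ?D. card {v \<in> set_tree t. balanced_vertex t v})"
    using fin by (simp add: card_SigmaI)
  also have "\<dots> = (\<Sum>t \<in> ?D. balanced_count t)"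
    by (intro sum.cong refl card_balanced_vertices) (simp add: decreasing_trees_on_def)
  finally have bal: "real (card (tree_vertices n \<inter> ?bal)) = fact n * mean_balanced n"
    using sum_balanced_count[of "{1..n}"] by simp
  have "balanced_probability n = real (card (tree_vertices n \<inter> ?bal)) / real (card (tree_vertices n))"
    unfolding balanced_probability_def
    by (rule measure_pmf_of_set[OF tree_vertices_nonempty[OF assms] finite_tree_vertices])
  then show ?thesis unfolding all bal by simp
qed

section \<open>The root is rarely balanced in a large tree\<close>

lemma rank_prob_nonneg: "rank_prob k n \<ge> 0"
  by (induction k arbitrary: n)
    (auto simp: rank_prob.simps split: nat.split intro!: divide_nonneg_pos add_nonneg_nonneg sum_nonneg)

lemma rank_prob_small: "n \<le> k \<Longrightarrow> rank_prob k n = 0"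
proof (induction k arbitrary: n)
  case (Suc k)
  then show ?case by (auto simp: rank_prob.simps split: nat.split intro!: sum.neutral)
qed (simp add: rank_prob.simps)

text \<open>
  A tree of rank \<open>k\<close> has at most as many vertices as the complete one, \<open>2 ^ Suc k - 1\<close>.
\<close>

lemma rank_prob_large: "n \<ge> 2 ^ Suc k \<Longrightarrow> rank_prob k n = 0"
proof (induction k arbitrary: n)
  case (Suc k)
  then obtain m where m: "n = Suc m" by (cases n) auto
  have zero: "rank_prob k i * rank_prob k (m - i) = 0" for i
  proof (cases "i \<ge> 2 ^ Suc k")
    case False
    then have "m - i \<ge> 2 ^ Suc k" using Suc.prems m by simp
    then show ?thesis using Suc.IH by simp
  qed (use Suc.IH in simp)
  have "m \<ge> 2 ^ Suc k" using Suc.prems m by simp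
  then have "rank_prob k m = 0" by (rule Suc.IH)
  then show ?case unfolding m by (simp only: rank_prob.simps nat.case zero) simp
qed (simp add: rank_prob.simps)

lemma balanced_prob_nonneg: "balanced_prob n \<ge> 0"
  by (simp add: balanced_prob_def sum_nonneg rank_prob_nonneg)

lemma root_weight_nonneg: "root_weight n \<ge> 0"
  by (simp add: root_weight_def balanced_prob_nonneg)

text \<open>
  The double sum adds up, over all sizes \<open>i\<close> of the left subtree, the probability that both subtrees
  are nonempty and have balanced roots of equal rank. The hypothesis excludes the one-vertex tree, whose
  root is balanced without having a child.
\<close>

lemma root_weight_Suc:
  assumes "m \<ge> 1"
  shows "root_weight (Suc m) = 2 * balanced_prob m +
           (\<Sum>i\<le>m. \<Sum>k<m. rank_prob k i * rank_prob k (m - i))"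
proof -
  have "root_weight (Suc m) = (\<Sum>k<Suc m. real (Suc m) * rank_prob k (Suc m))"
    by (simp only: root_weight_def balanced_prob_def sum_distrib_left)
  also have "\<dots> = (\<Sum>k<m. real (Suc m) * rank_prob (Suc k) (Suc m))"
    using assms by (subst sum.lessThan_Suc_shift) (simp add: rank_prob_0_left)
  also have "\<dots> = (\<Sum>k<m. 2 * rank_prob k m + (\<Sum>i\<le>m. rank_prob k i * rank_prob k (m - i)))"
    by (simp only: rank_prob_Suc_Suc)
  also have "\<dots> = 2 * (\<Sum>k<m. rank_prob k m) +
      (\<Sum>k<m. \<Sum>i\<le>m. rank_prob k i * rank_prob k (m - i))"
    by (simp add: sum.distrib sum_distrib_left)
  also have "(\<Sum>k<m. \<Sum>i\<le>m. rank_prob k i * rank_prob k (m - i)) =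
      (\<Sum>i\<le>m. \<Sum>k<m. rank_prob k i * rank_prob k (m - i))"
    by (rule sum.swap)
  finally show ?thesis by (simp add: balanced_prob_def)
qed

text \<open>
  The recurrence written out for the sizes at which exact values are computed. The parameters \<open>k\<close> and
  \<open>j\<close> are separate so that numerals can be substituted for both.
\<close>

lemma rank_prob_step:
  assumes "k = Suc j"
  shows
  "rank_prob k 1 = 0"
  "rank_prob k 2 = rank_prob j 1"
  "rank_prob k 3 = (2 * rank_prob j 2 + rank_prob j 1 ^ 2) / 3"
  "rank_prob k 4 = (2 * rank_prob j 3 + 2 * rank_prob j 1 * rank_prob j 2) / 4"
  "rank_prob k 5 =
     (2 * rank_prob j 4 + 2 * rank_prob j 1 * rank_prob j 3 + rank_prob j 2 ^ 2) / 5"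
  "rank_prob k 6 =
     (2 * rank_prob j 5 + 2 * rank_prob j 1 * rank_prob j 4 + 2 * rank_prob j 2 * rank_prob j 3) / 6"
  "rank_prob k 7 =
     (2 * rank_prob j 6 + 2 * rank_prob j 1 * rank_prob j 5 + 2 * rank_prob j 2 * rank_prob j 4
        + rank_prob j 3 ^ 2) / 7"
  unfolding assms by (simp_all add: rank_prob.simps eval_nat_numeral)

lemma rank_prob_0:
  "rank_prob 0 1 = 1" "rank_prob 0 2 = 0" "rank_prob 0 3 = 0" "rank_prob 0 4 = 0"
  "rank_prob 0 5 = 0" "rank_prob 0 6 = 0" "rank_prob 0 7 = 0"
  by (simp_all add: rank_prob.simps)

lemma rank_prob_1:
  "rank_prob 1 1 = 0" "rank_prob 1 2 = 1" "rank_prob 1 3 = 1/3" "rank_prob 1 4 = 0"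
  "rank_prob 1 5 = 0" "rank_prob 1 6 = 0" "rank_prob 1 7 = 0"
proof -
  have "1 = Suc 0" by simp
  note step = rank_prob_step[OF this]
  show "rank_prob 1 1 = 0" "rank_prob 1 2 = 1" "rank_prob 1 3 = 1/3" "rank_prob 1 4 = 0"
    "rank_prob 1 5 = 0" "rank_prob 1 6 = 0" "rank_prob 1 7 = 0"
    unfolding step rank_prob_0 by simp_all
qed

lemma rank_prob_2:
  "rank_prob 2 1 = 0" "rank_prob 2 2 = 0" "rank_prob 2 3 = 2/3" "rank_prob 2 4 = 1/6"
  "rank_prob 2 5 = 1/5" "rank_prob 2 6 = 1/9" "rank_prob 2 7 = 1/63"
proof -
  have "2 = Suc 1" by simp
  note step = rank_prob_step[OF this]
  show "rank_prob 2 1 = 0" "rank_prob 2 2 = 0" "rank_prob 2 3 = 2/3" "rank_prob 2 4 = 1/6"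
    "rank_prob 2 5 = 1/5" "rank_prob 2 6 = 1/9" "rank_prob 2 7 = 1/63"
    unfolding step rank_prob_1 by (simp_all add: power2_eq_square)
qed

lemma rank_prob_3:
  "rank_prob 3 1 = 0" "rank_prob 3 2 = 0" "rank_prob 3 3 = 0" "rank_prob 3 4 = 1/3"
  "rank_prob 3 5 = 1/15" "rank_prob 3 6 = 1/15" "rank_prob 3 7 = 2/21"
proof -
  have "3 = Suc 2" by simp
  note step = rank_prob_step[OF this]
  show "rank_prob 3 1 = 0" "rank_prob 3 2 = 0" "rank_prob 3 3 = 0" "rank_prob 3 4 = 1/3"
    "rank_prob 3 5 = 1/15" "rank_prob 3 6 = 1/15" "rank_prob 3 7 = 2/21"
    unfolding step rank_prob_2 by (simp_all add: power2_eq_square)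
qed

lemma rank_prob_4:
  "rank_prob 4 1 = 0" "rank_prob 4 2 = 0" "rank_prob 4 3 = 0" "rank_prob 4 4 = 0"
  "rank_prob 4 5 = 2/15" "rank_prob 4 6 = 1/45" "rank_prob 4 7 = 2/105"
proof -
  have "4 = Suc 3" by simp
  note step = rank_prob_step[OF this]
  show "rank_prob 4 1 = 0" "rank_prob 4 2 = 0" "rank_prob 4 3 = 0" "rank_prob 4 4 = 0"
    "rank_prob 4 5 = 2/15" "rank_prob 4 6 = 1/45" "rank_prob 4 7 = 2/105"
    unfolding step rank_prob_3 by simp_all
qed

lemma rank_prob_5:
  "rank_prob 5 1 = 0" "rank_prob 5 2 = 0" "rank_prob 5 3 = 0" "rank_prob 5 4 = 0"
  "rank_prob 5 5 = 0" "rank_prob 5 6 = 2/45" "rank_prob 5 7 = 2/315"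
proof -
  have "5 = Suc 4" by simp
  note step = rank_prob_step[OF this]
  show "rank_prob 5 1 = 0" "rank_prob 5 2 = 0" "rank_prob 5 3 = 0" "rank_prob 5 4 = 0"
    "rank_prob 5 5 = 0" "rank_prob 5 6 = 2/45" "rank_prob 5 7 = 2/315"
    unfolding step rank_prob_4 by simp_all
qed

lemma rank_prob_6: "rank_prob 6 7 = 4/315"
proof -
  have "6 = Suc 5" by simp
  note step = rank_prob_step(7)[OF this]
  show ?thesis unfolding step rank_prob_5 by simp
qed

lemmas rank_prob_table =
  rank_prob_0 rank_prob_1 rank_prob_2 rank_prob_3 rank_prob_4 rank_prob_5 rank_prob_6

lemma sum_lessThan_numerals:
  fixes g :: "nat \<Rightarrow> real"
  shows "sum g {..<1} = g 0"
    "sum g {..<2} = g 0 + g 1"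
    "sum g {..<3} = g 0 + g 1 + g 2"
    "sum g {..<4} = g 0 + g 1 + g 2 + g 3"
    "sum g {..<5} = g 0 + g 1 + g 2 + g 3 + g 4"
    "sum g {..<6} = g 0 + g 1 + g 2 + g 3 + g 4 + g 5"
    "sum g {..<7} = g 0 + g 1 + g 2 + g 3 + g 4 + g 5 + g 6"
  by (simp_all add: eval_nat_numeral)

lemma balanced_prob_values:
  "balanced_prob 1 = 1" "balanced_prob 2 = 1" "balanced_prob 3 = 1" "balanced_prob 4 = 1/2"
  "balanced_prob 5 = 2/5" "balanced_prob 6 = 11/45" "balanced_prob 7 = 47/315"
  unfolding balanced_prob_def sum_lessThan_numerals rank_prob_table by simp_all

lemma root_weight_values:
  "root_weight 1 = 1" "root_weight 2 = 2" "root_weight 3 = 3" "root_weight 4 = 2"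
  "root_weight 5 = 2" "root_weight 6 = 22/15" "root_weight 7 = 47/45"
  unfolding root_weight_def balanced_prob_values by simp_all

text \<open>
  The probability that two independent decreasing trees with \<open>n\<close> vertices have balanced roots of
  the same rank.
\<close>

definition collision :: "nat \<Rightarrow> real" where
  "collision n = (\<Sum>k<n. rank_prob k n ^ 2)"

lemma collision_values:
  "collision 4 = 5/36" "collision 5 = 14/225"
  unfolding collision_def sum_lessThan_numerals rank_prob_table by (simp_all add: power2_eq_square)

lemma collision_nonneg: "collision n \<ge> 0"
  by (simp add: collision_def sum_nonneg)

lemma collision_le: "collision n \<le> balanced_prob n ^ 2"
proof -
  have "collision n \<le> (\<Sum>k<n. rank_prob k n * balanced_prob n)"
    unfolding collision_def power2_eq_square balanced_prob_def
    by (intro sum_mono mult_left_mono member_le_sum) (auto simp: rank_prob_nonneg)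
  also have "\<dots> = balanced_prob n ^ 2"
    by (simp add: balanced_prob_def power2_eq_square sum_distrib_right)
  finally show ?thesis .
qed

lemma collision_eq:
  assumes "n \<le> m" shows "(\<Sum>k<m. rank_prob k n ^ 2) = collision n"
  unfolding collision_def using assms
  by (intro sum.mono_neutral_right) (auto simp: rank_prob_small)

text \<open>
  The sum on the left pairs the sizes \<open>i\<close> and \<open>m - i\<close>. Bounding a product by half the sum of the
  squares decouples them, and by the symmetry of the range under \<open>i \<mapsto> m - i\<close> each of the two resulting
  halves is half of the sum on the right.
\<close>

lemma same_rank_tail:
  "(\<Sum>i=4..m-4. \<Sum>k<m. rank_prob k i * rank_prob k (m - i)) \<le> (\<Sum>i=4..m-4. collision i)"
proof -
  have amgm: "x * y \<le> (x\<^sup>2 + y\<^sup>2) / 2" for x y :: real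
    using sum_squares_bound[of x y] by simp
  have "(\<Sum>i=4..m-4. \<Sum>k<m. rank_prob k i * rank_prob k (m - i)) \<le>
      (\<Sum>i=4..m-4. \<Sum>k<m. (rank_prob k i ^ 2 + rank_prob k (m - i) ^ 2) / 2)"
    by (intro sum_mono amgm)
  also have "\<dots> = (\<Sum>i=4..m-4. (collision i + collision (m - i)) / 2)"
  proof (intro sum.cong refl)
    fix i assume "i \<in> {4..m - 4}"
    then have "i \<le> m" by auto
    then show "(\<Sum>k<m. (rank_prob k i ^ 2 + rank_prob k (m - i) ^ 2) / 2) =
        (collision i + collision (m - i)) / 2"
      using collision_eq[of i m] collision_eq[of "m - i" m]
      by (simp add: sum.distrib flip: sum_divide_distrib)
  qed
  also have "\<dots> = ((\<Sum>i=4..m-4. collision i) + (\<Sum>i=4..m-4. collision (m - i))) / 2"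
    by (simp add: sum.distrib flip: sum_divide_distrib)
  also have "(\<Sum>i=4..m-4. collision (m - i)) = (\<Sum>i=4..m-4. collision i)"
    by (intro sum.reindex_bij_witness[of _ "\<lambda>i. m - i" "\<lambda>i. m - i"]) auto
  finally show ?thesis by simp
qed

text \<open>
  Two subtrees of total size \<open>m \<ge> 7\<close>, one of them with \<open>j \<le> 3\<close> vertices: the small one has rank less
  than \<open>j\<close>, while the other has at least four vertices and thus rank at least \<open>2\<close>. The only remaining
  coincidence is rank \<open>2\<close> with \<open>j = 3\<close>, and a tree with three vertices has rank \<open>2\<close> with
  probability \<open>2/3\<close>.
\<close>

lemma same_rank_small:
  assumes "m \<ge> 7"
  shows "(\<Sum>k<m. rank_prob k 1 * rank_prob k (m - 1)) = 0"
    and "(\<Sum>k<m. rank_prob k 2 * rank_prob k (m - 2)) = 0"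
    and "(\<Sum>k<m. rank_prob k 3 * rank_prob k (m - 3)) = 2/3 * rank_prob 2 (m - 3)"
proof -
  \<comment> \<open>A tree with j vertices has rank less than j.\<close>
  have *: "(\<Sum>k<m. rank_prob k j * rank_prob k (m - j)) = (\<Sum>k<j. rank_prob k j * rank_prob k (m - j))"
    if "j \<le> m" for j
    using that by (intro sum.mono_neutral_right) (auto simp: rank_prob_small)
  have "rank_prob 0 (m - j) = 0" if "j \<le> 3" for j
    using that assms by (intro rank_prob_large) auto
  moreover have "rank_prob 1 (m - j) = 0" if "j \<le> 3" for j
    using that assms by (intro rank_prob_large) auto
  ultimately show "(\<Sum>k<m. rank_prob k 1 * rank_prob k (m - 1)) = 0"
    and "(\<Sum>k<m. rank_prob k 2 * rank_prob k (m - 2)) = 0"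
    and "(\<Sum>k<m. rank_prob k 3 * rank_prob k (m - 3)) = 2/3 * rank_prob 2 (m - 3)"
    using assms *[of 1] *[of 2] *[of 3] unfolding sum_lessThan_numerals rank_prob_table
    by simp_all
qed

lemma sum_split_ends:
  fixes g :: "nat \<Rightarrow> real"
  assumes "m \<ge> 7" "\<And>i. i \<le> m \<Longrightarrow> g (m - i) = g i"
  shows "(\<Sum>i\<le>m. g i) = 2 * (g 0 + g 1 + g 2 + g 3) + (\<Sum>i=4..m-4. g i)"
proof -
  have "{..m} = {0,1,2,3} \<union> {4..m-4} \<union> {m, m-1, m-2, m-3}"
    using assms(1) by (auto simp: not_less)
  also have "sum g \<dots> = sum g ({0,1,2,3} \<union> {4..m-4}) + sum g {m, m-1, m-2, m-3}"
    using assms(1) by (intro sum.union_disjoint) auto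
  also have "sum g ({0,1,2,3} \<union> {4..m-4}) = sum g {0,1,2,3} + sum g {4..m-4}"
    by (intro sum.union_disjoint) auto
  also have "sum g {m, m-1, m-2, m-3} = g m + g (m-1) + g (m-2) + g (m-3)"
  proof -
    obtain j where "m = j + 7" using assms(1) by (metis le_add_diff_inverse2)
    then show ?thesis by (simp add: eval_nat_numeral add.assoc)
  qed
  finally show ?thesis
    using assms(2)[of 0] assms(2)[of 1] assms(2)[of 2] assms(2)[of 3] assms(1) by simp
qed

lemma root_weight_bound:
  assumes "m \<ge> 7"
  shows "root_weight (Suc m) \<le>
    2 * balanced_prob m + 4/3 * rank_prob 2 (m - 3) + (\<Sum>i=4..m-4. collision i)"
proof -
  define g where "g i = (\<Sum>k<m. rank_prob k i * rank_prob k (m - i))" for i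
  have "g (m - i) = g i" if "i \<le> m" for i
    using that by (simp add: g_def mult.commute)
  then have "(\<Sum>i\<le>m. g i) = 2 * (g 0 + g 1 + g 2 + g 3) + (\<Sum>i=4..m-4. g i)"
    using assms by (intro sum_split_ends)
  moreover have "g 0 = 0" "g 1 = 0" "g 2 = 0" "g 3 = 2/3 * rank_prob 2 (m - 3)"
    using same_rank_small[OF assms] by (simp_all add: g_def)
  moreover have "(\<Sum>i=4..m-4. g i) \<le> (\<Sum>i=4..m-4. collision i)"
    unfolding g_def by (rule same_rank_tail)
  ultimately show ?thesis
    using root_weight_Suc[of m] assms unfolding g_def[symmetric] by simp
qed

text \<open>
  Comparison with the telescoping sum of \<open>1/(i - 1) - 1/i\<close>, which starts at \<open>1/7\<close>.
\<close>

lemma sum_collision_tail: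
  assumes "\<And>i. 8 \<le> i \<Longrightarrow> i \<le> M \<Longrightarrow> collision i \<le> c / real i ^ 2" and "c \<ge> 0"
  shows "(\<Sum>i=8..M. collision i) \<le> c / 7"
proof -
  have tele: "(\<Sum>i=8..M. 1 / real i ^ 2) \<le> 1/7 - 1 / real (max 7 M)" for M
  proof (induction M)
    case (Suc M)
    show ?case
    proof (cases "M \<ge> 7")
      case True
      have "1 / real (Suc M) ^ 2 \<le> 1 / real M - 1 / real (Suc M)"
        using True by (simp add: divide_simps power2_eq_square)
          (simp add: algebra_simps)?
      then show ?thesis using Suc True by (simp add: sum.atLeast_Suc_atMost max_def)
    next
      case False
      then show ?thesis by (simp add: max_def)
    qed
  qed simp
  have "(\<Sum>i=8..M. collision i) \<le> (\<Sum>i=8..M. c * (1 / real i ^ 2))"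
    using assms(1) by (intro sum_mono) auto
  also have "\<dots> = c * (\<Sum>i=8..M. 1 / real i ^ 2)" by (simp only: sum_distrib_left)
  also have "\<dots> \<le> c * (1/7)"
    using tele[of M] assms(2) by (intro mult_left_mono order_trans[OF tele]) auto
  finally show ?thesis by simp
qed

text \<open>
  For \<open>m \<ge> 9\<close> the bound of \<open>root_weight_bound\<close> closes up uniformly: its three terms are at most
  \<open>19/135\<close>, \<open>4/27\<close> and about \<open>0.340\<close>, and \<open>19/30\<close> exceeds their sum, but only by about \<open>0.004\<close>.
  For \<open>m = 7\<close> and \<open>m = 8\<close> the middle term alone is \<open>2/9\<close> and \<open>4/15\<close>, and one needs that the sum of
  collision probabilities has at most one term.
\<close>

lemma root_weight_le:
  assumes "n \<ge> 8"
  shows "root_weight n \<le> 19/30"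
  using assms
proof (induction n rule: less_induct)
  case (less n)
  then obtain m where n: "n = Suc m" and m: "m \<ge> 7" by (cases n) auto
  have IH: "balanced_prob i \<le> 19/30 / real i" if "8 \<le> i" "i \<le> m" for i
    using less.IH[of i] that n by (simp add: root_weight_def field_simps)
  consider "m = 7" | "m = 8" | "m \<ge> 9" using m by linarith
  then show ?case
  proof cases
    case 1
    then show ?thesis
      using root_weight_bound[of 7] n by (simp add: balanced_prob_values rank_prob_table)
  next
    case 2
    then show ?thesis
      using root_weight_bound[of 8] IH[of 8] n
      by (simp add: collision_values rank_prob_table)
  next
    case 3
    have b: "balanced_prob m \<le> 19/270"
    proof -
      have "19/30 / real m \<le> 19/30 / 9" using 3 by (intro divide_left_mono) auto
      then show ?thesis using IH[of m] 3 by simp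
    qed
    have r: "rank_prob 2 (m - 3) \<le> 1/9"
    proof -
      consider "m = 9" | "m = 10" | "m - 3 \<ge> 8" using 3 by linarith
      then show ?thesis
        by cases (simp_all add: rank_prob_table rank_prob_large)
    qed
    have c: "collision i \<le> (19/30)\<^sup>2 / real i ^ 2" if "8 \<le> i" "i \<le> m - 4" for i
    proof -
      have "collision i \<le> balanced_prob i ^ 2" by (rule collision_le)
      also have "\<dots> \<le> (19/30 / real i) ^ 2"
        using IH[of i] that by (intro power_mono balanced_prob_nonneg) auto
      finally show ?thesis by (simp add: power_divide)
    qed
    have "(\<Sum>i=4..m-4. collision i) \<le> (\<Sum>i \<in> {4,5,6,7} \<union> {8..m-4}. collision i)"
      by (intro sum_mono2) (auto simp: collision_nonneg)
    also have "\<dots> = (\<Sum>i \<in> {4,5,6,7}. collision i) + (\<Sum>i=8..m-4. collision i)"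
      by (intro sum.union_disjoint) auto
    also have "\<dots> \<le> 5/36 + 14/225 + (11/45)\<^sup>2 + (47/315)\<^sup>2 + (19/30)\<^sup>2 / 7"
      using collision_le[of 6] collision_le[of 7] sum_collision_tail[of "m - 4" "(19/30)\<^sup>2"] c
      by (simp add: collision_values balanced_prob_values)
    finally show ?thesis
      using root_weight_bound[OF m] b r n by (simp add: power2_eq_square)
  qed
qed

section \<open>The proportion of balanced vertices decreases\<close>

lemma mean_balanced_recurrence:
  "real (Suc m) * mean_balanced (Suc m) =
     (real m + 2) * mean_balanced m + root_weight (Suc m) - root_weight m"
proof (cases m)
  case 0
  then show ?thesis using mean_balanced_Suc[of 0] by (simp add: root_weight_def)
next
  case (Suc j)
  have "2 * (\<Sum>i\<le>m. mean_balanced i) = 2 * (\<Sum>i\<le>j. mean_balanced i) + 2 * mean_balanced m"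
    unfolding Suc by (simp only: sum.atMost_Suc distrib_left)
  moreover have "real m * mean_balanced m = 2 * (\<Sum>i\<le>j. mean_balanced i) + root_weight m"
    using mean_balanced_Suc[of j] Suc by simp
  ultimately show ?thesis
    using mean_balanced_Suc[of m] by (simp add: algebra_simps)
qed

lemma mean_balanced_values:
  "mean_balanced 1 = 1" "mean_balanced 2 = 2" "mean_balanced 3 = 3" "mean_balanced 4 = 7/2"
proof -
  show 1: "mean_balanced 1 = 1"
    using mean_balanced_recurrence[of 0] root_weight_values
    by (simp add: root_weight_def mean_balanced.simps)
  show 2: "mean_balanced 2 = 2"
    using mean_balanced_recurrence[of 1] 1 root_weight_values by (simp add: numeral_2_eq_2)
  show 3: "mean_balanced 3 = 3"
    using mean_balanced_recurrence[of 2] 2 root_weight_values by simp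
  show "mean_balanced 4 = 7/2"
    using mean_balanced_recurrence[of 3] 3 root_weight_values by simp
qed

text \<open>
  The sequence \<open>c * (n + 1)\<close> solves the recurrence of \<open>mean_balanced\<close> without its inhomogeneous term,
  except for the initial value \<open>0\<close>, so a lower bound on the partial sums by those of \<open>c * (n + 1)\<close>
  propagates. The constant is the best one at the starting point: \<open>A\<^sub>0 + \<dots> + A\<^sub>4 = 19/2\<close>, which is
  \<open>19/30 * (1 + 2 + 3 + 4 + 5)\<close>.
\<close>

lemma mean_balanced_lower:
  assumes "n \<ge> 4"
  shows "mean_balanced n \<ge> 19/30 * (real n + 1)"
proof -
  have ind: "mean_balanced (Suc m) \<ge> 19/30 * (real m + 2)"
    if "(\<Sum>i\<le>m. mean_balanced i) \<ge> 19/60 * (real m + 1) * (real m + 2)" for m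
  proof -
    have "(real m + 1) * (19/30 * (real m + 2)) \<le> (real m + 1) * mean_balanced (Suc m)"
      using mean_balanced_Suc[of m] that root_weight_nonneg[of "Suc m"]
      by (simp add: algebra_simps)
    then show ?thesis by (rule mult_left_le_imp_le) simp
  qed
  have S: "(\<Sum>i\<le>m. mean_balanced i) \<ge> 19/60 * (real m + 1) * (real m + 2)" if "m \<ge> 4" for m
    using that
  proof (induction m rule: dec_induct)
    case base
    have "(\<Sum>i\<le>4. mean_balanced i) =
        mean_balanced 0 + mean_balanced 1 + mean_balanced 2 + mean_balanced 3 + mean_balanced 4"
      by (simp add: eval_nat_numeral)
    then show ?case using mean_balanced_values by (simp add: mean_balanced.simps)
  next
    case (step m)
    then show ?case using ind[of m] by (simp add: algebra_simps)
  qed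
  show ?thesis
  proof (cases "n = 4")
    case False
    then obtain m where "n = Suc m" "m \<ge> 4" using assms by (cases n) auto
    then show ?thesis using ind[of m] S[of m] by simp
  qed (simp add: mean_balanced_values)
qed

text \<open>
  Equality holds for \<open>m = 1\<close> and \<open>m = 2\<close>: in a tree with at most three vertices every vertex is
  balanced. This is why small cases cannot be absorbed into the general estimate.
\<close>

lemma root_weight_increment:
  assumes "m \<ge> 1"
  shows "real m * (root_weight (Suc m) - root_weight m) \<le> mean_balanced m"
proof -
  consider "m = 1" | "m = 2" | "m = 3" | "m = 4" | "m = 5" | "m = 6" | "m \<ge> 7"
    using assms by linarith
  then show ?thesis
  proof cases
    case 1
    then show ?thesis using root_weight_values mean_balanced_values by (simp add: numeral_2_eq_2)
  next
    case 4
    then show ?thesis using root_weight_values mean_balanced_values by simp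
  next
    case 5
    then show ?thesis using root_weight_values mean_balanced_lower[of 5] by simp
  next
    case 6
    then show ?thesis using root_weight_values mean_balanced_lower[of 6] by simp
  next
    case 7
    have "real m * (root_weight (Suc m) - root_weight m) \<le> real m * (19/30)"
      using root_weight_le[of "Suc m"] root_weight_nonneg[of m] 7
      by (intro mult_left_mono) auto
    also have "\<dots> \<le> mean_balanced m"
      using mean_balanced_lower[of m] 7 by simp
    finally show ?thesis .
  qed (use root_weight_values mean_balanced_values in simp_all)
qed

text \<open>
  Multiplied by \<open>m * (m + 1)\<^sup>2\<close>, the claim compares \<open>m * (m + 2) * A\<^sub>m + m * (q\<^bsub>m+1\<^esub> - q\<^sub>m)\<close> with
  \<open>(m + 1)\<^sup>2 * A\<^sub>m\<close>. Since \<open>(m + 1)\<^sup>2 = m * (m + 2) + 1\<close>, the increment of \<open>q\<close> has exactly one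
  \<open>A\<^sub>m\<close> to spare.
\<close>

lemma mean_balanced_ratio_antimono:
  assumes "m \<ge> 1"
  shows "mean_balanced (Suc m) / real (Suc m) \<le> mean_balanced m / real m"
proof -
  have "real m * (real (Suc m) * mean_balanced (Suc m)) =
      real m * (real m + 2) * mean_balanced m + real m * (root_weight (Suc m) - root_weight m)"
    unfolding mean_balanced_recurrence by (simp add: algebra_simps)
  also have "\<dots> \<le> real m * (real m + 2) * mean_balanced m + mean_balanced m"
    using root_weight_increment[OF assms] by simp
  also have "\<dots> = real (Suc m) * (real (Suc m) * mean_balanced m)"
    by (simp add: algebra_simps)
  finally have "real (Suc m) * (real m * mean_balanced (Suc m)) \<le>
      real (Suc m) * (real (Suc m) * mean_balanced m)"
    by (simp add: mult_ac)
  then have "real m * mean_balanced (Suc m) \<le> real (Suc m) * mean_balanced m"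
    by (rule mult_left_le_imp_le) simp
  then show ?thesis using assms by (simp add: field_simps)
qed

theorem theorem1p3:
  fixes n :: nat
  assumes "n \<ge> 1"
  shows "balanced_probability n \<ge> balanced_probability (n + 1)"
  using mean_balanced_ratio_antimono[OF assms] assms by (simp add: balanced_probability_eq)

end
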